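(* Let $f:\mathbb{N}\to\mathbb{R}$ be a nonnegative arithmetic function and let $k\ge 2$ be an integer. If $f$ is sub-multiplicative and super-homogeneous, then $f$ is $k$-super-homogeneous. If $f$ is super-multiplicative and sub-homogeneous, then $f$ is $k$-sub-homogeneous.
   Context: $\mathbb{N}=\{1,2,3,\dots\}$. $f$ is sub-multiplicative if $f(mn)\le f(m)f(n)$ for all $m,n\ge1$, super-multiplicative if $f(mn)\ge f(m)f(n)$ for all $m,n\ge1$. $f$ is sub-homogeneous if $f(mn)\le m f(n)$ for all $m,n\ge1$, super-homogeneous if $f(mn)\ge m f(n)$ for all $m,n\ge1$. For an integer $k\ge2$, $f$ is $k$-sub-homogeneous if $\big(f(mn)\big)^k\le m^k f(n^k)$ for all $m,n\ge1$, and $k$-super-homogeneous if $\big(f(mn)\big)^k\ge m^k f(n^k)$ for all $m,n\ge1$. *)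

theory Defs imports Complex_Main begin

(* An arithmetic function on {1, 2, 3, ...} is rendered as a function on nat whose
   value at 0 is irrelevant: every definition only inspects arguments n >= 1. *)

definition nonneg_arith :: "(nat \<Rightarrow> real) \<Rightarrow> bool" where
  "nonneg_arith f \<longleftrightarrow> (\<forall>n\<ge>1. f n \<ge> 0)"

definition sub_multiplicative :: "(nat \<Rightarrow> real) \<Rightarrow> bool" where
  "sub_multiplicative f \<longleftrightarrow> (\<forall>m\<ge>1. \<forall>n\<ge>1. f (m * n) \<le> f m * f n)"

definition super_multiplicative :: "(nat \<Rightarrow> real) \<Rightarrow> bool" where
  "super_multiplicative f \<longleftrightarrow> (\<forall>m\<ge>1. \<forall>n\<ge>1. f (m * n) \<ge> f m * f n)"

definition sub_homogeneous :: "(nat \<Rightarrow> real) \<Rightarrow> bool" where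
  "sub_homogeneous f \<longleftrightarrow> (\<forall>m\<ge>1. \<forall>n\<ge>1. f (m * n) \<le> real m * f n)"

definition super_homogeneous :: "(nat \<Rightarrow> real) \<Rightarrow> bool" where
  "super_homogeneous f \<longleftrightarrow> (\<forall>m\<ge>1. \<forall>n\<ge>1. f (m * n) \<ge> real m * f n)"

definition k_sub_homogeneous :: "nat \<Rightarrow> (nat \<Rightarrow> real) \<Rightarrow> bool" where
  "k_sub_homogeneous k f \<longleftrightarrow>
    (\<forall>m\<ge>1. \<forall>n\<ge>1. (f (m * n)) ^ k \<le> real m ^ k * f (n ^ k))"

definition k_super_homogeneous :: "nat \<Rightarrow> (nat \<Rightarrow> real) \<Rightarrow> bool" where
  "k_super_homogeneous k f \<longleftrightarrow>
    (\<forall>m\<ge>1. \<forall>n\<ge>1. (f (m * n)) ^ k \<ge> real m ^ k * f (n ^ k))"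

end

theory Submission imports Defs begin

text \<open>Iterating sub-multiplicativity along the powers of n gives f(n^k) \<le> f(n)^k
  (\<open>sub_multiplicative_power\<close>). Super-homogeneity gives m f(n) \<le> f(mn), and taking
  k-th powers preserves order between nonnegative numbers, so m^k f(n^k) \<le> (m f(n))^k \<le>
  f(mn)^k. The other half is the same chain reversed, resting on
  \<open>super_multiplicative_power\<close>.\<close>

text \<open>Induction peels off one factor n at a time. It starts at exponent 1: at 0 the claim
  would read f(1) \<le> 1, which fails for the constant function 2.\<close>

lemma sub_multiplicative_power:
  assumes "nonneg_arith f" "sub_multiplicative f" "n \<ge> 1" "k \<ge> 1"
  shows "f (n ^ k) \<le> f n ^ k"
  using assms(4)
proof (induction k rule: nat_induct_at_least)
  case base
  show ?case by simp
next
  case (Suc k)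
  have "f (n ^ Suc k) \<le> f n * f (n ^ k)"
    using assms by (simp add: sub_multiplicative_def)
  also have "\<dots> \<le> f n * f n ^ k"
    using Suc.IH assms by (simp add: mult_left_mono nonneg_arith_def)
  finally show ?case by simp
qed

text \<open>Dual induction, again from exponent 1: at 0 the claim would read 1 \<le> f(1), which
  fails for the zero function.\<close>

lemma super_multiplicative_power:
  assumes "nonneg_arith f" "super_multiplicative f" "n \<ge> 1" "k \<ge> 1"
  shows "f n ^ k \<le> f (n ^ k)"
  using assms(4)
proof (induction k rule: nat_induct_at_least)
  case base
  show ?case by simp
next
  case (Suc k)
  have "f n ^ Suc k \<le> f n * f (n ^ k)"
    using Suc.IH assms by (simp add: mult_left_mono nonneg_arith_def)
  also have "\<dots> \<le> f (n ^ Suc k)"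
    using assms by (simp add: super_multiplicative_def)
  finally show ?case .
qed

lemma k_super_homogeneousI:
  assumes "nonneg_arith f" "sub_multiplicative f" "super_homogeneous f" "k \<ge> 1"
  shows "k_super_homogeneous k f"
  unfolding k_super_homogeneous_def
proof (intro allI impI)
  fix m n :: nat
  assume mn: "m \<ge> 1" "n \<ge> 1"
  have "real m ^ k * f (n ^ k) \<le> real m ^ k * f n ^ k"
    using sub_multiplicative_power[OF assms(1,2) mn(2) assms(4)] by (simp add: mult_left_mono)
  also have "\<dots> = (real m * f n) ^ k"
    by (simp add: power_mult_distrib)
  \<comment> \<open>Monotonicity of the power needs the smaller base, here
    \<open>real m * f n\<close>, to be nonnegative.\<close>
  also have "\<dots> \<le> f (m * n) ^ k"
    using assms mn by (intro power_mono) (auto simp: super_homogeneous_def nonneg_arith_def)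
  finally show "real m ^ k * f (n ^ k) \<le> f (m * n) ^ k" .
qed

lemma k_sub_homogeneousI:
  assumes "nonneg_arith f" "super_multiplicative f" "sub_homogeneous f" "k \<ge> 1"
  shows "k_sub_homogeneous k f"
  unfolding k_sub_homogeneous_def
proof (intro allI impI)
  fix m n :: nat
  assume mn: "m \<ge> 1" "n \<ge> 1"
  \<comment> \<open>Here the smaller base is \<open>f (m * n)\<close>, nonnegative because
    \<open>m * n\<close> is at least 1.\<close>
  have "f (m * n) ^ k \<le> (real m * f n) ^ k"
    using assms mn by (intro power_mono) (auto simp: sub_homogeneous_def nonneg_arith_def)
  also have "\<dots> = real m ^ k * f n ^ k"
    by (simp add: power_mult_distrib)
  also have "\<dots> \<le> real m ^ k * f (n ^ k)"
    using super_multiplicative_power[OF assms(1,2) mn(2) assms(4)] by (simp add: mult_left_mono)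
  finally show "f (m * n) ^ k \<le> real m ^ k * f (n ^ k)" .
qed

theorem theorem3:
  fixes f :: "nat \<Rightarrow> real" and k :: nat
  assumes "nonneg_arith f" and "k \<ge> 2"
  shows "(sub_multiplicative f \<and> super_homogeneous f \<longrightarrow> k_super_homogeneous k f) \<and>
         (super_multiplicative f \<and> sub_homogeneous f \<longrightarrow> k_sub_homogeneous k f)"
  using assms k_super_homogeneousI[of f k] k_sub_homogeneousI[of f k] by simp

end
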